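(* For every integer $k \geq 0$, there exists a graph $G_k$ having an induced subgraph $H_k$ such that $\chi_L(H_k) - \chi_L(G_k) = k$ and $\chi_{NL}(H_k) - \chi_{NL}(G_k) = k$.
   Context: All graphs are finite and simple. For a proper $k$-coloring $f$ of $G$ with color classes $S_1,\dots,S_k$, two vertices $x,y$ are metric-distinguished if $d(x,S_i)\neq d(y,S_i)$ for some $i$, where $d(x,S)=\min\{d(x,z): z\in S\}$ and $d$ is the shortest-path distance; $f$ is a locating $k$-coloring if any two distinct vertices are metric-distinguished, and $\chi_L(G)$ is the minimum $k$ for which $G$ admits a locating $k$-coloring. For a vertex $x$, let $N_f(x)=\{f(y): y \text{ adjacent to } x\}$. Two vertices $x,y$ are neighbor-distinguished if $f(x)\neq f(y)$ or $N_f(x)\neq N_f(y)$; $f$ is a neighbor-locating $k$-coloring if every two distinct vertices are neighbor-distinguished, and $\chi_{NL}(G)$ is the minimum $k$ for which $G$ admits a neighbor-locating $k$-coloring. *)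

theory Defs
  imports "Graph_Theory.Graph_Theory"
begin

text \<open>
  Following the library, a finite simple graph is a finite symmetric digraph without loops and
  parallel arcs (locale \<open>graph\<close>); the undirected edge \<open>{u, v}\<close> is the pair of arcs \<open>(u, v)\<close>, \<open>(v, u)\<close>.

  The distance is the library's shortest-path cost for the constant weight 1. It is
  \<open>\<infinity>\<close> between vertices of different components.
\<close>

definition gdist :: "('a, 'b) pre_digraph \<Rightarrow> 'a \<Rightarrow> 'a \<Rightarrow> ereal" where
  "gdist G u v = wf_digraph.\<mu> G (\<lambda>_. 1) u v"

text \<open>For the empty set the value is \<open>\<infinity>\<close>, so an unused colour never distinguishes two vertices.\<close>

definition set_gdist :: "('a, 'b) pre_digraph \<Rightarrow> 'a \<Rightarrow> 'a set \<Rightarrow> ereal" where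
  "set_gdist G x S = (INF z\<in>S. gdist G x z)"

definition proper_coloring :: "('a, 'b) pre_digraph \<Rightarrow> nat \<Rightarrow> ('a \<Rightarrow> nat) \<Rightarrow> bool" where
  "proper_coloring G k f \<longleftrightarrow>
     f ` verts G \<subseteq> {1..k} \<and> (\<forall>u v. u \<rightarrow>\<^bsub>G\<^esub> v \<longrightarrow> f u \<noteq> f v)"

definition color_class :: "('a, 'b) pre_digraph \<Rightarrow> ('a \<Rightarrow> nat) \<Rightarrow> nat \<Rightarrow> 'a set" where
  "color_class G f i = {v \<in> verts G. f v = i}"

definition metric_distinguished ::
  "('a, 'b) pre_digraph \<Rightarrow> nat \<Rightarrow> ('a \<Rightarrow> nat) \<Rightarrow> 'a \<Rightarrow> 'a \<Rightarrow> bool" where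
  "metric_distinguished G k f x y \<longleftrightarrow>
     (\<exists>i\<in>{1..k}. set_gdist G x (color_class G f i) \<noteq> set_gdist G y (color_class G f i))"

definition locating_coloring :: "('a, 'b) pre_digraph \<Rightarrow> nat \<Rightarrow> ('a \<Rightarrow> nat) \<Rightarrow> bool" where
  "locating_coloring G k f \<longleftrightarrow> proper_coloring G k f \<and>
     (\<forall>x\<in>verts G. \<forall>y\<in>verts G. x \<noteq> y \<longrightarrow> metric_distinguished G k f x y)"

definition locating_chromatic_number :: "('a, 'b) pre_digraph \<Rightarrow> nat" (\<open>\<chi>\<^sub>L\<close>) where
  "\<chi>\<^sub>L G = (LEAST k. \<exists>f. locating_coloring G k f)"

definition neighbor_colors :: "('a, 'b) pre_digraph \<Rightarrow> ('a \<Rightarrow> nat) \<Rightarrow> 'a \<Rightarrow> nat set" where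
  "neighbor_colors G f x = f ` {y. x \<rightarrow>\<^bsub>G\<^esub> y}"

definition neighbor_distinguished ::
  "('a, 'b) pre_digraph \<Rightarrow> ('a \<Rightarrow> nat) \<Rightarrow> 'a \<Rightarrow> 'a \<Rightarrow> bool" where
  "neighbor_distinguished G f x y \<longleftrightarrow>
     f x \<noteq> f y \<or> neighbor_colors G f x \<noteq> neighbor_colors G f y"

definition neighbor_locating_coloring ::
  "('a, 'b) pre_digraph \<Rightarrow> nat \<Rightarrow> ('a \<Rightarrow> nat) \<Rightarrow> bool" where
  "neighbor_locating_coloring G k f \<longleftrightarrow> proper_coloring G k f \<and>
     (\<forall>x\<in>verts G. \<forall>y\<in>verts G. x \<noteq> y \<longrightarrow> neighbor_distinguished G f x y)"

definition neighbor_locating_chromatic_number :: "('a, 'b) pre_digraph \<Rightarrow> nat" (\<open>\<chi>\<^sub>N\<^sub>L\<close>) where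
  "\<chi>\<^sub>N\<^sub>L G = (LEAST k. \<exists>f. neighbor_locating_coloring G k f)"

text \<open>Both minima are taken over nonempty sets: colour all vertices differently.\<close>

lemma gdist_self:
  assumes "wf_digraph G" "u \<in> verts G"
  shows "gdist G u u = 0"
proof -
  interpret wf_digraph G by fact
  have "gdist G u u \<le> 0"
    using min_cost_le_walk_cost[of u "[]" u "\<lambda>_. 1"] assms(2)
    by (simp add: gdist_def awalk_Nil_iff zero_ereal_def)
  moreover have "0 \<le> gdist G u u"
    unfolding gdist_def \<mu>_def
    by (rule INF_greatest) (auto simp: zero_ereal_def awalk_cost_def sum_list_triv)
  ultimately show ?thesis by (rule antisym)
qed

lemma gdist_ge_1:
  assumes "wf_digraph G" "u \<noteq> v"
  shows "1 \<le> gdist G u v"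
proof -
  interpret wf_digraph G by fact
  have "1 \<le> ereal (awalk_cost (\<lambda>_. 1) p)" if "awalk u p v" for p
    using that assms(2)
    by (cases p) (auto simp: awalk_Nil_iff one_ereal_def awalk_cost_def sum_list_triv)
  then show ?thesis
    unfolding gdist_def \<mu>_def by (intro INF_greatest) auto
qed

lemma injective_coloring:
  assumes "graph G"
  obtains f k where "locating_coloring G k f" "neighbor_locating_coloring G k f"
proof -
  interpret graph G by fact
  obtain f where f: "bij_betw f (verts G) {1..card (verts G)}"
    using ex_bij_betw_finite_nat[OF finite_verts]
    by (metis bij_betw_iff_card card_atLeastAtMost diff_Suc_1 finite_atLeastAtMost finite_verts)
  let ?k = "card (verts G)"
  have inj: "f x \<noteq> f y" if "x \<in> verts G" "y \<in> verts G" "x \<noteq> y" for x y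
    using f that by (auto simp: bij_betw_def inj_on_def)
  have proper: "proper_coloring G ?k f"
    using f inj adj_not_same adj_in_verts
    unfolding proper_coloring_def bij_betw_def by (metis order_refl)
  have "metric_distinguished G ?k f x y" if xy: "x \<in> verts G" "y \<in> verts G" "x \<noteq> y" for x y
  proof -
    have "color_class G f (f x) = {x}"
      using inj xy by (auto simp: color_class_def)
    then have "set_gdist G x (color_class G f (f x)) = 0"
      "1 \<le> set_gdist G y (color_class G f (f x))"
      using gdist_self[of G x] gdist_ge_1[of G y x] xy by (auto simp: set_gdist_def wf_digraph)
    moreover have "f x \<in> {1..?k}"
      using f xy by (auto simp: bij_betw_def)
    ultimately show ?thesis
      unfolding metric_distinguished_def by (intro bexI[of _ "f x"]) auto
  qed
  with proper have "locating_coloring G ?k f"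
    by (simp add: locating_coloring_def)
  moreover from proper inj have "neighbor_locating_coloring G ?k f"
    by (simp add: neighbor_locating_coloring_def neighbor_distinguished_def)
  ultimately show thesis by (rule that)
qed

end

theory Submission
  imports Defs
begin

text \<open>
  Since colours of neighbours are exactly the colours at distance 1, every neighbour-locating
  colouring is locating, so it suffices to bound \<open>\<chi>\<^sub>L\<close> from below and \<open>\<chi>\<^sub>N\<^sub>L\<close> from above.
  An edgeless graph needs as many colours as it has vertices, so \<open>H\<close> may be an independent set of \<open>G\<close>
  with \<open>k\<close> more vertices than \<open>G\<close> needs colours. For \<open>G\<close>, take a clique on \<open>c = k + 3\<close> vertices,
  hang one leaf on each of \<open>k\<close> of them, and add \<open>c\<close> isolated vertices. The clique forces \<open>c\<close>
  colours; conversely \<open>c\<close> colours suffice, because within one colour the clique vertex, the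
  isolated vertex and the leaf see at least two, zero and one colours, respectively. The leaves and the
  isolated vertices form an independent set of size \<open>c + k\<close>.
\<close>

section \<open>From neighbor-locating to locating colorings\<close>

lemma (in wf_digraph) gdist_adj_le_1:
  assumes "u \<rightarrow>\<^bsub>G\<^esub> v"
  shows "gdist G u v \<le> 1"
proof -
  from assms obtain e where "e \<in> arcs G" "tail G e = u" "head G e = v"
    by (auto simp: arcs_ends_def arc_to_ends_def)
  then have "awalk u [e] v"
    by (auto simp: awalk_def)
  from min_cost_le_walk_cost[OF this, of "\<lambda>_. 1"] show ?thesis
    by (simp add: gdist_def one_ereal_def)
qed

lemma (in wf_digraph) gdist_ge_2:
  assumes "u \<noteq> v" "\<not> u \<rightarrow>\<^bsub>G\<^esub> v"
  shows "2 \<le> gdist G u v"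
proof -
  have "ereal 2 \<le> ereal (awalk_cost (\<lambda>_. 1) p)" if p: "awalk u p v" for p
  proof -
    from p assms(1) obtain e q where q: "p = e # q"
      by (cases p) (auto simp: awalk_Nil_iff)
    with p assms(2) have "q \<noteq> []"
      by (auto simp: awalk_Cons_iff awalk_Nil_iff arcs_ends_def arc_to_ends_def)
    then have "2 \<le> length p"
      using q by (cases q) auto
    then show ?thesis
      by (simp add: awalk_cost_def sum_list_triv)
  qed
  then show ?thesis
    unfolding gdist_def \<mu>_def by (intro INF_greatest) auto
qed

lemma (in wf_digraph) gdist_edgeless:
  assumes "arcs G = {}" "u \<noteq> v"
  shows "gdist G u v = \<infinity>"
proof -
  have "{p. awalk u p v} = {}"
    using assms by (auto simp: awalk_def cas.simps elim: cas.elims)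
  then show ?thesis
    by (simp add: gdist_def \<mu>_def top_ereal_def)
qed

lemma (in wf_digraph) metric_distinguished_if_neighbor_color:
  assumes "proper_coloring G k f" "f x = f y"
    and i: "i \<in> neighbor_colors G f x" "i \<notin> neighbor_colors G f y"
  shows "metric_distinguished G k f x y"
proof -
  from i(1) obtain z where z: "x \<rightarrow>\<^bsub>G\<^esub> z" "f z = i"
    by (auto simp: neighbor_colors_def)
  have zv: "z \<in> verts G"
    using z(1) adj_in_verts by blast
  have "set_gdist G x (color_class G f i) \<le> gdist G x z"
    unfolding set_gdist_def using zv z(2) by (intro INF_lower) (auto simp: color_class_def)
  also have "\<dots> \<le> 1"
    using z(1) by (rule gdist_adj_le_1)
  finally have le: "set_gdist G x (color_class G f i) \<le> 1" .
  \<comment> \<open>Color \<open>i\<close> occurs next to \<open>x\<close>, and \<open>y\<close> has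
    the color of \<open>x\<close>. So \<open>y\<close> is not in class \<open>i\<close> itself, and
    as no neighbor of \<open>y\<close> is either, the class is at distance at least 2.\<close>
  have "f y \<noteq> i"
    using assms(1,2) z by (auto simp: proper_coloring_def)
  then have "2 \<le> set_gdist G y (color_class G f i)"
    unfolding set_gdist_def using i(2)
    by (intro INF_greatest gdist_ge_2) (auto simp: color_class_def neighbor_colors_def)
  with le have "set_gdist G x (color_class G f i) \<noteq> set_gdist G y (color_class G f i)"
    by (auto dest: order_trans)
  moreover have "i \<in> {1..k}"
    using assms(1) zv z(2) by (auto simp: proper_coloring_def)
  ultimately show ?thesis
    by (auto simp: metric_distinguished_def)
qed

lemma metric_distinguished_sym:
  "metric_distinguished G k f x y \<longleftrightarrow> metric_distinguished G k f y x"
  unfolding metric_distinguished_def by metis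

text \<open>The color class of \<open>x\<close> itself separates the two: distance 0 against at
  least 1.\<close>

lemma (in wf_digraph) metric_distinguished_if_color:
  assumes "proper_coloring G k f" "x \<in> verts G" "f x \<noteq> f y"
  shows "metric_distinguished G k f x y"
proof -
  have "set_gdist G x (color_class G f (f x)) \<le> gdist G x x"
    unfolding set_gdist_def using assms(2) by (intro INF_lower) (auto simp: color_class_def)
  also have "\<dots> = 0"
    using assms(2) wf_digraph_axioms by (rule gdist_self[rotated])
  finally have "set_gdist G x (color_class G f (f x)) \<le> 0" .
  moreover have "1 \<le> set_gdist G y (color_class G f (f x))"
    unfolding set_gdist_def using assms(3)
    by (intro INF_greatest gdist_ge_1[OF wf_digraph_axioms]) (auto simp: color_class_def)
  ultimately have "set_gdist G x (color_class G f (f x)) \<noteq> set_gdist G y (color_class G f (f x))"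
    by (auto dest: order_trans)
  moreover have "f x \<in> {1..k}"
    using assms(1,2) by (auto simp: proper_coloring_def)
  ultimately show ?thesis
    by (auto simp: metric_distinguished_def)
qed

lemma (in wf_digraph) neighbor_locating_imp_locating:
  assumes "neighbor_locating_coloring G k f"
  shows "locating_coloring G k f"
  unfolding locating_coloring_def
proof (intro conjI ballI impI)
  show proper: "proper_coloring G k f"
    using assms by (simp add: neighbor_locating_coloring_def)
  fix x y assume xy: "x \<in> verts G" "y \<in> verts G" "x \<noteq> y"
  then consider "f x \<noteq> f y"
    | i where "f x = f y" "i \<in> neighbor_colors G f x" "i \<notin> neighbor_colors G f y"
    | i where "f y = f x" "i \<in> neighbor_colors G f y" "i \<notin> neighbor_colors G f x"
    using assms unfolding neighbor_locating_coloring_def neighbor_distinguished_def by fastforce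
  then show "metric_distinguished G k f x y"
  proof cases
    case 1
    then show ?thesis by (rule metric_distinguished_if_color[OF proper xy(1)])
  next
    case 2
    then show ?thesis by (rule metric_distinguished_if_neighbor_color[OF proper])
  next
    case 3
    then have "metric_distinguished G k f y x"
      by (rule metric_distinguished_if_neighbor_color[OF proper])
    then show ?thesis by (subst metric_distinguished_sym)
  qed
qed

text \<open>One lower bound serves both numbers because neighbor-locating colorings are
  locating.\<close>

lemma (in wf_digraph) locating_chromatic_numbers_eqI:
  assumes nl: "neighbor_locating_coloring G n f"
    and lower: "\<And>m g. locating_coloring G m g \<Longrightarrow> n \<le> m"
  shows "\<chi>\<^sub>L G = n" "\<chi>\<^sub>N\<^sub>L G = n"
  unfolding locating_chromatic_number_def neighbor_locating_chromatic_number_def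
  using nl lower neighbor_locating_imp_locating
  by (blast intro: Least_equality)+

section \<open>Lower bounds from cliques and from edgeless graphs\<close>

lemma (in wf_digraph) proper_coloring_clique_le:
  assumes "proper_coloring G m f" "K \<subseteq> verts G"
    and "\<And>u v. u \<in> K \<Longrightarrow> v \<in> K \<Longrightarrow> u \<noteq> v \<Longrightarrow> u \<rightarrow>\<^bsub>G\<^esub> v"
  shows "card K \<le> m"
proof -
  have "inj_on f K"
    using assms(1,3) unfolding proper_coloring_def inj_on_def by metis
  moreover have "f ` K \<subseteq> {1..m}"
    using assms(1,2) by (auto simp: proper_coloring_def)
  ultimately show ?thesis
    using card_inj_on_le[of f K "{1..m}"] by simp
qed

text \<open>Without edges, the distances to the color classes reveal nothing about \<open>x\<close>
  beyond its color, so a locating coloring must be injective.\<close>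

lemma (in wf_digraph) set_gdist_edgeless:
  assumes "arcs G = {}" "x \<in> verts G"
  shows "set_gdist G x (color_class G f i) = (if f x = i then 0 else \<infinity>)"
proof (cases "f x = i")
  case True
  have "set_gdist G x (color_class G f i) \<le> gdist G x x"
    unfolding set_gdist_def using assms(2) True
    by (intro INF_lower) (auto simp: color_class_def)
  moreover have "0 \<le> gdist G x z" for z
    using gdist_self[OF wf_digraph_axioms assms(2)] gdist_edgeless[OF assms(1), of x z]
    by (cases "x = z") auto
  then have "0 \<le> set_gdist G x (color_class G f i)"
    unfolding set_gdist_def by (intro INF_greatest)
  ultimately show ?thesis
    using True gdist_self[OF wf_digraph_axioms assms(2)] by simp
next
  case False
  \<comment> \<open>This includes an empty class, whose infimum is infinite as well.\<close>
  then have "\<infinity> \<le> set_gdist G x (color_class G f i)"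
    unfolding set_gdist_def
    by (intro INF_greatest) (auto simp: color_class_def intro!: gdist_edgeless[OF assms(1)])
  with False show ?thesis by simp
qed

lemma (in wf_digraph) locating_coloring_edgeless_le:
  assumes "arcs G = {}" "locating_coloring G m f"
  shows "card (verts G) \<le> m"
proof -
  have "inj_on f (verts G)"
  proof (rule inj_onI, rule ccontr)
    fix x y assume "x \<in> verts G" "y \<in> verts G" "f x = f y" "x \<noteq> y"
    then show False
      using assms(2) set_gdist_edgeless[OF assms(1), of _ f]
      unfolding locating_coloring_def metric_distinguished_def by fastforce
  qed
  moreover have "f ` verts G \<subseteq> {1..m}"
    using assms(2) by (auto simp: locating_coloring_def proper_coloring_def)
  ultimately show ?thesis
    using card_inj_on_le[of f "verts G" "{1..m}"] by simp
qed

section \<open>The graph and its coloring by residues\<close>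

text \<open>
  With \<open>c = k + 3\<close>, the clique is \<open>{..<c}\<close>, the vertices in \<open>{c..<2 * c}\<close> are isolated, and the
  leaf \<open>2 * c + i\<close> hangs on \<open>i + 1\<close>, for \<open>i < k\<close>. In this way every vertex can be coloured by
  its residue modulo \<open>c\<close>.
\<close>

definition leafed_clique :: "nat \<Rightarrow> nat pair_pre_digraph" where
  "leafed_clique k = (let c = k + 3; E = {(i + 1, 2 * c + i) | i. i < k} in
     \<lparr>pverts = {..<2 * c + k}, parcs = {(u, v). u < c \<and> v < c \<and> u \<noteq> v} \<union> E \<union> E\<inverse>\<rparr>)"

definition leafed_clique_independent :: "nat \<Rightarrow> nat pair_pre_digraph" where
  "leafed_clique_independent k = \<lparr>pverts = {k + 3..<2 * (k + 3) + k}, parcs = {}\<rparr>"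

lemma verts_leafed_clique: "pverts (leafed_clique k) = {..<2 * (k + 3) + k}"
  by (simp add: leafed_clique_def Let_def)

lemma parcs_leafed_clique_iff:
  "(u, v) \<in> parcs (leafed_clique k) \<longleftrightarrow> u < k + 3 \<and> v < k + 3 \<and> u \<noteq> v \<or>
     (\<exists>i<k. u = i + 1 \<and> v = 2 * (k + 3) + i) \<or> (\<exists>i<k. v = i + 1 \<and> u = 2 * (k + 3) + i)"
  by (auto simp: leafed_clique_def Let_def)

lemma graph_leafed_clique: "graph (leafed_clique k)"
proof -
  have "pair_graph (leafed_clique k)"
  proof
    show "finite (parcs (leafed_clique k))"
      by (rule finite_subset[of _ "{..<2 * (k + 3) + k} \<times> {..<2 * (k + 3) + k}"])
        (auto simp: leafed_clique_def Let_def)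
  qed (auto simp: leafed_clique_def Let_def symmetric_def intro!: symI)
  then show ?thesis by (rule pair_graph.pair_graphD_graph)
qed

lemma neighbor_locating_coloring_leafed_clique:
  "neighbor_locating_coloring (leafed_clique k) (k + 3) (\<lambda>v. v mod (k + 3) + 1)"
proof -
  define c where "c = k + 3"
  define f where "f = (\<lambda>v. v mod c + 1)"
  define N where "N = neighbor_colors (leafed_clique k) f"
  \<comment> \<open>As \<open>k < c\<close>, all vertices lie below \<open>3 * c\<close>, so at most
    two subtractions of \<open>c\<close> reach the residue.\<close>
  have f_eq: "f v = (if v < c then v else if v < 2 * c then v - c else v - 2 * c) + 1"
    if "v < 2 * c + k" for v
  proof -
    have "k < c" by (simp add: c_def)
    with that have "\<not> v < 2 * c \<Longrightarrow> (v - c) mod c = v - 2 * c"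
      by (subst le_mod_geq) auto
    then show ?thesis
      by (auto simp: f_def le_mod_geq)
  qed
  have proper: "proper_coloring (leafed_clique k) c f"
    unfolding proper_coloring_def
  proof (intro conjI allI impI)
    show "f ` verts (leafed_clique k) \<subseteq> {1..c}"
      by (auto simp: f_def c_def Suc_le_eq)
    fix u v assume "u \<rightarrow>\<^bsub>leafed_clique k\<^esub> v"
    then have "u < c \<and> v < c \<and> u \<noteq> v \<or>
        (\<exists>i<k. u = i + 1 \<and> v = 2 * c + i) \<or> (\<exists>i<k. v = i + 1 \<and> u = 2 * c + i)"
      by (simp add: parcs_leafed_clique_iff c_def)
    \<comment> \<open>The leaf \<open>2 * c + i\<close> gets color \<open>i + 1\<close> and its
      neighbor \<open>i + 1\<close> gets color \<open>i + 2\<close>; hanging the leaf on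
      \<open>i\<close> would make these colors equal.\<close>
    then show "f u \<noteq> f v"
      by (elim disjE exE conjE) (simp_all add: f_eq c_def)
  qed
  \<comment> \<open>The other \<open>c - 1 = k + 2\<close> clique vertices have distinct colors. The
    3 in \<open>c = k + 3\<close> gives two of them even for \<open>k = 0\<close>.\<close>
  have clique: "card (N v) \<ge> 2" if "v < c" for v
  proof -
    have "f u \<in> N v" if "u \<in> {..<c} - {v}" for u
      using that \<open>v < c\<close> by (auto simp: N_def neighbor_colors_def parcs_leafed_clique_iff c_def)
    then have sub: "f ` ({..<c} - {v}) \<subseteq> N v" by blast
    have "inj_on f ({..<c} - {v})"
      by (auto simp: inj_on_def f_def)
    then have "card (f ` ({..<c} - {v})) = c - 1"
      using that by (simp add: card_image)
    moreover have "finite (N v)"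
      by (rule finite_subset[of _ "{..c}"])
        (auto simp: N_def neighbor_colors_def f_def c_def Suc_le_eq)
    ultimately show ?thesis
      using card_mono[OF _ sub] by (simp add: c_def)
  qed
  have isolated: "N v = {}" if "c \<le> v" "v < 2 * c" for v
    using that by (auto simp: N_def neighbor_colors_def parcs_leafed_clique_iff c_def)
  have leaf: "N v = {f (v - 2 * c + 1)}" if "2 * c \<le> v" "v < 2 * c + k" for v
  proof -
    have "{y. v \<rightarrow>\<^bsub>leafed_clique k\<^esub> y} = {v - 2 * c + 1}"
      using that by (auto simp: parcs_leafed_clique_iff c_def)
    then show ?thesis by (simp add: N_def neighbor_colors_def)
  qed
  have "N x \<noteq> N y" if xy: "x < 2 * c + k" "y < 2 * c + k" "x < y" "f x = f y" for x y
  proof -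
    \<comment> \<open>Clique, isolated vertices and leaves each contain a residue at most once, so
      \<open>x\<close> lies in an earlier block than \<open>y\<close>.\<close>
    have "x < c \<and> c \<le> y \<or> c \<le> x \<and> x < 2 * c \<and> 2 * c \<le> y"
      using xy by (auto simp: f_eq split: if_splits)
    moreover have "card (N y) \<le> 1" if "c \<le> y"
      using isolated[of y] leaf[of y] xy(2) that by (cases "y < 2 * c") auto
    ultimately show ?thesis
      using clique[of x] isolated[of x] leaf[of y] xy(2) by fastforce
  qed
  then have "neighbor_distinguished (leafed_clique k) f x y"
    if "x < 2 * c + k" "y < 2 * c + k" "x \<noteq> y" for x y
    using that unfolding neighbor_distinguished_def N_def by (metis linorder_neqE_nat)
  with proper show ?thesis
    by (simp add: neighbor_locating_coloring_def verts_leafed_clique c_def f_def)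
qed

lemma locating_chromatic_numbers_leafed_clique:
  "\<chi>\<^sub>L (leafed_clique k) = k + 3" "\<chi>\<^sub>N\<^sub>L (leafed_clique k) = k + 3"
proof -
  interpret graph "leafed_clique k" by (rule graph_leafed_clique)
  have "k + 3 \<le> m" if "locating_coloring (leafed_clique k) m g" for m g
  proof -
    have "proper_coloring (leafed_clique k) m g"
      using that by (simp add: locating_coloring_def)
    then have "card {..<k + 3} \<le> m"
      by (rule proper_coloring_clique_le) (auto simp: verts_leafed_clique parcs_leafed_clique_iff)
    then show ?thesis by simp
  qed
  then show "\<chi>\<^sub>L (leafed_clique k) = k + 3" "\<chi>\<^sub>N\<^sub>L (leafed_clique k) = k + 3"
    using locating_chromatic_numbers_eqI[OF neighbor_locating_coloring_leafed_clique] by blast+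
qed

section \<open>The independent set as induced subgraph\<close>

lemma induced_subgraph_leafed_clique:
  "induced_subgraph (leafed_clique_independent k) (leafed_clique k)"
proof -
  interpret graph "leafed_clique k" by (rule graph_leafed_clique)
  \<comment> \<open>Every edge of the big graph has an end in the clique, so the vertices from
    \<open>k + 3\<close> on induce no arcs.\<close>
  show ?thesis
    unfolding induced_subgraph_def subgraph_def
    by (auto simp: leafed_clique_def leafed_clique_independent_def Let_def compatible_def
        wf_digraph_axioms[unfolded leafed_clique_def Let_def] wf_digraph_def)
qed

lemma locating_chromatic_numbers_leafed_clique_independent:
  "\<chi>\<^sub>L (leafed_clique_independent k) = 2 * k + 3"
  "\<chi>\<^sub>N\<^sub>L (leafed_clique_independent k) = 2 * k + 3"
proof -
  let ?H = "with_proj (leafed_clique_independent k)"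
  interpret wf_digraph ?H
    by standard (auto simp: leafed_clique_independent_def)
  \<comment> \<open>All vertices of \<open>?H\<close> are at least \<open>k + 3\<close>, so the
    subtraction is not truncated and the coloring numbers them injectively from 1.\<close>
  have "neighbor_locating_coloring ?H (2 * k + 3) (\<lambda>v. v - (k + 3) + 1)"
    by (auto simp: neighbor_locating_coloring_def proper_coloring_def neighbor_distinguished_def
        leafed_clique_independent_def)
  moreover have "2 * k + 3 \<le> m" if "locating_coloring ?H m g" for m g
    using locating_coloring_edgeless_le[OF _ that] by (simp add: leafed_clique_independent_def)
  ultimately show "\<chi>\<^sub>L ?H = 2 * k + 3" "\<chi>\<^sub>N\<^sub>L ?H = 2 * k + 3"
    using locating_chromatic_numbers_eqI by blast+
qed

theorem theorem2:
  fixes k :: nat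
  shows "\<exists>(G :: nat pair_pre_digraph) (H :: nat pair_pre_digraph).
    graph G \<and> induced_subgraph H G \<and>
    int (\<chi>\<^sub>L H) - int (\<chi>\<^sub>L G) = int k \<and>
    int (\<chi>\<^sub>N\<^sub>L H) - int (\<chi>\<^sub>N\<^sub>L G) = int k"
proof (intro exI conjI)
  show "graph (leafed_clique k)"
    by (rule graph_leafed_clique)
  show "induced_subgraph (leafed_clique_independent k) (leafed_clique k)"
    by (rule induced_subgraph_leafed_clique)
qed (simp_all add: locating_chromatic_numbers_leafed_clique
    locating_chromatic_numbers_leafed_clique_independent)

end
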